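(* Let $m\ge 1$ and $n\ge 0$ be integers, and let $\nu_{2l}^{m|0}$, $l=1,2,\ldots$, be a sequence of fundamental solutions of the natural powers of $\Delta_b=-\sum_{j=1}^m\partial_{x_j}^2$ on $\mathbb{R}^m$ satisfying $\Delta_b^j\nu_{2l}^{m|0}=\nu_{2l-2j}^{m|0}$ for $j<l$ and $\Delta_b^l\nu_{2l}^{m|0}=\delta(\underline{x})$. Then the function $\nu_2^{m|2n}$ defined by $$\nu_2^{m|2n}=\sum_{k=0}^n\frac{4^k\,k!}{(n-k)!}\,\nu_{2k+2}^{m|0}\,\underline{\grave{x}}^{2n-2k}$$ is a fundamental solution for the super Laplace operator $\Delta$, i.e. $\Delta\,\nu_2^{m|2n}=\delta(x)$ in the distributional sense.
   Context: Variables: $x_1,\ldots,x_m$ are commuting real variables (coordinates on $\mathbb{R}^m$); $\grave{x}_1,\ldots,\grave{x}_{2n}$ are anticommuting variables ($\grave{x}_i\grave{x}_j=-\grave{x}_j\grave{x}_i$) generating the real Grassmann algebra $\Lambda_{2n}$; the $x_i$ commute with the $\grave{x}_j$. $\mathcal{C}$ is the real associative unital algebra generated by $e_1,\ldots,e_m,\grave{e}_1,\ldots,\grave{e}_{2n}$ with relations $e_je_k+e_ke_j=-2\delta_{jk}$, $\grave{e}_{2j}\grave{e}_{2k}-\grave{e}_{2k}\grave{e}_{2j}=0$, $\grave{e}_{2j-1}\grave{e}_{2k-1}-\grave{e}_{2k-1}\grave{e}_{2j-1}=0$, $\grave{e}_{2j-1}\grave{e}_{2k}-\grave{e}_{2k}\grave{e}_{2j-1}=\delta_{jk}$,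 $e_j\grave{e}_k+\grave{e}_ke_j=0$. All $e_i,\grave{e}_j$ commute with all $x_i,\grave{x}_j$. Vector variables: $\underline{x}=\sum_{i=1}^m x_ie_i$, $\underline{\grave{x}}=\sum_{j=1}^{2n}\grave{x}_j\grave{e}_j$, $x=\underline{x}+\underline{\grave{x}}$. One has $\underline{\grave{x}}^2=\sum_{j=1}^n\grave{x}_{2j-1}\grave{x}_{2j}$, and $\underline{\grave{x}}^0=1$. Operators: $\partial_{\grave{x}_j}$ is the left derivative on the Grassmann algebra ($\partial_{\grave{x}_j}(\grave{x}_kF)=\delta_{jk}F-\grave{x}_k\partial_{\grave{x}_j}F$), commuting with the $x_i$, $e_i$, $\grave{e}_i$ and $\partial_{x_i}$. The super Laplace operator is $\Delta=\Delta_b+\Delta_f$ with $\Delta_b=-\sum_{j=1}^m\partial_{x_j}^2$ and $\Delta_f=4\sum_{j=1}^n\partial_{\grave{x}_{2j-1}}\partial_{\grave{x}_{2j}}$. Distributions: operators act on elements of $\mathcal{D}'(\mathbb{R}^m)\otimes\Lambda_{2n}\otimes\mathcal{C}$, with $\partial_{x_j}$ acting in the distributional sense on the first factor. $\delta(\underline{x})$ is the Dirac distribution at the origin of $\mathbb{R}^m$, and the super Dirac distribution is $\delta(x)=\delta(\underline{x})\,\grave{x}_1\cdots\grave{x}_{2n}=\delta(\underline{x})\,\underline{\grave{x}}^{2n}/n!$. *)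

theory Defs
  imports "HOL-Analysis.Analysis" "HOL-Library.Poly_Mapping"
begin

section \<open>Test functions\<close>

definition pderiv_at :: "'m::finite \<Rightarrow> (real^'m \<Rightarrow> real) \<Rightarrow> real^'m \<Rightarrow> real" where
  "pderiv_at i f x = deriv (\<lambda>t. f (x + t *\<^sub>R axis i 1)) 0"

definition smooth :: "(real^'m::finite \<Rightarrow> real) \<Rightarrow> bool" where
  "smooth f \<longleftrightarrow> (\<forall>is. continuous_on UNIV (fold pderiv_at is f) \<and>
     (\<forall>i x. (\<lambda>t. fold pderiv_at is f (x + t *\<^sub>R axis i 1)) field_differentiable at 0))"

definition test_function :: "(real^'m::finite \<Rightarrow> real) \<Rightarrow> bool" where
  "test_function f \<longleftrightarrow> smooth f \<and> compact (closure {x. f x \<noteq> 0})"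

lemma smooth_pderiv: "smooth f \<Longrightarrow> smooth (pderiv_at j f)"
  unfolding smooth_def
proof (intro allI)
  fix "is"
  assume "\<forall>is. continuous_on UNIV (fold pderiv_at is f) \<and>
     (\<forall>i x. (\<lambda>t. fold pderiv_at is f (x + t *\<^sub>R axis i 1)) field_differentiable at 0)"
  from this[rule_format, of "j # is"]
  show "continuous_on UNIV (fold pderiv_at is (pderiv_at j f)) \<and>
     (\<forall>i x. (\<lambda>t. fold pderiv_at is (pderiv_at j f) (x + t *\<^sub>R axis i 1)) field_differentiable at 0)"
    by simp
qed

lemma smooth_field_differentiable:
  "smooth f \<Longrightarrow> (\<lambda>t. f (x + t *\<^sub>R axis i 1)) field_differentiable at 0"
  unfolding smooth_def by (metis fold_simps(1))

lemma pderiv_at_add: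
  assumes "smooth f" "smooth g"
  shows "pderiv_at i (\<lambda>x. f x + g x) = (\<lambda>x. pderiv_at i f x + pderiv_at i g x)"
  unfolding pderiv_at_def
  using assms[THEN smooth_field_differentiable] by (intro ext deriv_add) auto

lemma pderiv_at_cmult:
  assumes "smooth f"
  shows "pderiv_at i (\<lambda>x. c * f x) = (\<lambda>x. c * pderiv_at i f x)"
  unfolding pderiv_at_def
  using assms[THEN smooth_field_differentiable] by (intro ext deriv_cmult) auto

lemma fold_pderiv_add:
  "smooth f \<Longrightarrow> smooth g \<Longrightarrow> fold pderiv_at is (\<lambda>x. f x + g x)
     = (\<lambda>x. fold pderiv_at is f x + fold pderiv_at is g x)"
  by (induction "is" arbitrary: f g) (simp_all add: pderiv_at_add smooth_pderiv)

lemma fold_pderiv_cmult: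
  "smooth f \<Longrightarrow> fold pderiv_at is (\<lambda>x. c * f x) = (\<lambda>x. c * fold pderiv_at is f x)"
  by (induction "is" arbitrary: f) (simp_all add: pderiv_at_cmult smooth_pderiv)

lemma smooth_add:
  assumes "smooth f" "smooth g" shows "smooth (\<lambda>x. f x + g x)"
  using assms unfolding smooth_def[of "\<lambda>x. f x + g x"] fold_pderiv_add[OF assms]
  by (auto simp: smooth_def intro!: continuous_intros field_differentiable_add)

lemma smooth_cmult:
  assumes "smooth f" shows "smooth (\<lambda>x. c * f x)"
  using assms unfolding smooth_def[of "\<lambda>x. c * f x"] fold_pderiv_cmult[OF assms]
  by (auto simp: smooth_def intro!: continuous_intros field_differentiable_mult field_differentiable_const)

lemma fold_pderiv_zero: "fold pderiv_at is (\<lambda>x. 0) = (\<lambda>x. 0)"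
  by (induction "is") (simp_all add: pderiv_at_def[abs_def])

lemma smooth_zero: "smooth (\<lambda>x. 0)"
  unfolding smooth_def fold_pderiv_zero by (auto simp: field_differentiable_const)

lemma compact_closure_subset:
  fixes A :: "(real^'m::finite) set"
  shows "A \<subseteq> B \<Longrightarrow> compact (closure B) \<Longrightarrow> compact (closure A)"
  by (meson bounded_closure bounded_subset compact_closure)

lemma test_function_zero: "test_function (\<lambda>x. 0)"
  by (simp add: test_function_def smooth_zero)

lemma test_function_add:
  assumes "test_function f" "test_function g" shows "test_function (\<lambda>x. f x + g x)"
proof -
  have "{x. f x + g x \<noteq> 0} \<subseteq> {x. f x \<noteq> 0} \<union> {x. g x \<noteq> 0}" by auto
  moreover have "compact (closure ({x. f x \<noteq> 0} \<union> {x. g x \<noteq> 0}))"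
    using assms by (auto simp: test_function_def)
  ultimately have "compact (closure {x. f x + g x \<noteq> 0})"
    by (rule compact_closure_subset)
  with assms show ?thesis by (simp add: test_function_def smooth_add)
qed

lemma test_function_cmult:
  assumes "test_function f" shows "test_function (\<lambda>x. c * f x)"
proof -
  have "{x. c * f x \<noteq> 0} \<subseteq> {x. f x \<noteq> 0}" by auto
  from compact_closure_subset[OF this] assms show ?thesis
    by (simp add: test_function_def smooth_cmult)
qed

lemma pderiv_support:
  fixes f :: "real^'m::finite \<Rightarrow> real"
  shows "{x. pderiv_at i f x \<noteq> 0} \<subseteq> closure {x. f x \<noteq> 0}"
proof (rule ccontr)
  assume "\<not> ?thesis"
  then obtain x where nz: "pderiv_at i f x \<noteq> 0" and x: "x \<notin> closure {x. f x \<noteq> 0}" by auto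
  define U where "U = {t. x + t *\<^sub>R axis i 1 \<in> - closure {x. f x \<noteq> 0}}"
  have "open U"
  proof -
    have "open ((\<lambda>t. x + t *\<^sub>R axis i 1) -` (- closure {x. f x \<noteq> 0}))"
      by (intro open_vimage continuous_intros) auto
    thus ?thesis by (simp add: U_def vimage_def)
  qed
  moreover have "0 \<in> U" using x by (simp add: U_def)
  ultimately have "eventually (\<lambda>t. t \<in> U) (nhds 0)" by (rule eventually_nhds_in_open)
  hence "eventually (\<lambda>t. f (x + t *\<^sub>R axis i 1) = 0) (nhds 0)"
    by eventually_elim (use closure_subset[of "{x. f x \<noteq> 0}"] in \<open>auto simp: U_def\<close>)
  hence "deriv (\<lambda>t. f (x + t *\<^sub>R axis i 1)) 0 = deriv (\<lambda>t. 0) (0::real)"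
    by (intro deriv_cong_ev) auto
  with nz show False by (simp add: pderiv_at_def)
qed

lemma test_function_pderiv:
  assumes "test_function f" shows "test_function (pderiv_at i f)"
  using assms compact_closure_subset[OF pderiv_support[of i f]]
  by (simp add: test_function_def smooth_pderiv)

typedef (overloaded) 'm test = "{f :: real^'m::finite \<Rightarrow> real. test_function f}"
  morphisms test_apply Abs_test
  using test_function_zero by blast

setup_lifting type_definition_test

instantiation test :: (finite) real_vector
begin

lift_definition zero_test :: "'a test" is "\<lambda>x. 0"
  by (rule test_function_zero)
lift_definition plus_test :: "'a test \<Rightarrow> 'a test \<Rightarrow> 'a test" is "\<lambda>f g x. f x + g x"
  by (rule test_function_add)
lift_definition scaleR_test :: "real \<Rightarrow> 'a test \<Rightarrow> 'a test" is "\<lambda>c f x. c * f x"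
  by (rule test_function_cmult)
definition uminus_test :: "'a test \<Rightarrow> 'a test" where "uminus_test f = (-1) *\<^sub>R f"
definition minus_test :: "'a test \<Rightarrow> 'a test \<Rightarrow> 'a test" where "minus_test f g = f + (-1) *\<^sub>R g"

instance
proof
  fix a b c :: "'a test" and r s :: real
  show "a + b + c = a + (b + c)" by transfer (simp add: add.assoc)
  show "a + b = b + a" by transfer (simp add: add.commute)
  show "0 + a = a" by transfer simp
  show "- a + a = 0" unfolding uminus_test_def by transfer simp
  show "a - b = a + - b" by (simp add: uminus_test_def minus_test_def)
  show "r *\<^sub>R (a + b) = r *\<^sub>R a + r *\<^sub>R b" by transfer (simp add: distrib_left)
  show "(r + s) *\<^sub>R a = r *\<^sub>R a + s *\<^sub>R a" by transfer (simp add: distrib_right)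
  show "r *\<^sub>R s *\<^sub>R a = (r * s) *\<^sub>R a" by transfer (simp add: mult.assoc)
  show "1 *\<^sub>R a = a" by transfer simp
qed

end

lift_definition test_pderiv :: "'m::finite \<Rightarrow> 'm test \<Rightarrow> 'm test" is pderiv_at
  by (rule test_function_pderiv)

definition test_seminorm :: "nat \<Rightarrow> 'm::finite test \<Rightarrow> real" where
  "test_seminorm N \<phi> =
     (\<Sum>is | length is \<le> N. SUP x. \<bar>fold pderiv_at is (test_apply \<phi>) x\<bar>)"


section \<open>Distributions\<close>

text \<open>
  Continuity on the test functions is expressed by the usual estimate on each compact set:
  \<open>T\<close> is bounded by finitely many suprema of partial derivatives.
\<close>

definition distribution :: "('m::finite test \<Rightarrow> real) \<Rightarrow> bool" where
  "distribution T \<longleftrightarrow> linear T \<and>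
     (\<forall>K. compact K \<longrightarrow> (\<exists>C N. \<forall>\<phi>. {x. test_apply \<phi> x \<noteq> 0} \<subseteq> K \<longrightarrow>
        \<bar>T \<phi>\<bar> \<le> C * test_seminorm N \<phi>))"

lemma test_fold_pderiv: "test_function (fold pderiv_at is (test_apply \<phi>))"
proof -
  have "test_function f \<Longrightarrow> test_function (fold pderiv_at is f)" for f :: "real^'a \<Rightarrow> real"
    by (induction "is" arbitrary: f) (auto intro: test_function_pderiv)
  thus ?thesis using test_apply by blast
qed

lemma test_function_bdd:
  assumes "test_function f" shows "bdd_above (range (\<lambda>x. \<bar>f x\<bar>))"
proof -
  let ?K = "closure {x. f x \<noteq> 0}"
  have "continuous_on UNIV f"
    using assms unfolding test_function_def smooth_def by (metis fold_simps(1))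
  hence "continuous_on ?K (\<lambda>x. \<bar>f x\<bar>)"
    by (intro continuous_intros) (auto intro: continuous_on_subset)
  hence "compact ((\<lambda>x. \<bar>f x\<bar>) ` ?K)"
    using assms by (intro compact_continuous_image) (auto simp: test_function_def)
  then obtain B where B: "\<And>x. x \<in> ?K \<Longrightarrow> \<bar>f x\<bar> \<le> B"
    by (meson bounded_imp_bdd_above bdd_above.E compact_imp_bounded image_eqI)
  have "\<bar>f x\<bar> \<le> max B 0" for x
    using B[of x] closure_subset[of "{x. f x \<noteq> 0}"] by (cases "f x = 0") force+
  thus ?thesis by (intro bdd_aboveI) auto
qed

lemma SUP_test_nonneg: "0 \<le> (SUP x. \<bar>fold pderiv_at is (test_apply \<phi>) x\<bar>)"
  by (rule cSUP_upper2[OF test_function_bdd[OF test_fold_pderiv], of 0]) auto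

lemma finite_short_lists: "finite {is :: 'm::finite list. length is \<le> N}"
  using finite_lists_length_le[of "UNIV :: 'm set"] by simp

lemma test_seminorm_nonneg: "0 \<le> test_seminorm N \<phi>"
  unfolding test_seminorm_def by (intro sum_nonneg SUP_test_nonneg)

lemma test_seminorm_mono: "N \<le> M \<Longrightarrow> test_seminorm N \<phi> \<le> test_seminorm M \<phi>"
  unfolding test_seminorm_def
  by (intro sum_mono2 finite_short_lists SUP_test_nonneg) auto

lemma test_seminorm_pderiv: "test_seminorm N (test_pderiv i \<phi>) \<le> test_seminorm (Suc N) \<phi>"
proof -
  let ?g = "\<lambda>is. SUP x. \<bar>fold pderiv_at is (test_apply \<phi>) x\<bar>"
  have "test_seminorm N (test_pderiv i \<phi>) = (\<Sum>is | length is \<le> N. ?g (i # is))"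
    by (simp add: test_seminorm_def test_pderiv.rep_eq)
  also have "\<dots> = sum ?g ((#) i ` {is. length is \<le> N})"
    by (subst sum.reindex) auto
  also have "\<dots> \<le> test_seminorm (Suc N) \<phi>"
    unfolding test_seminorm_def
    by (intro sum_mono2 finite_short_lists SUP_test_nonneg) auto
  finally show ?thesis .
qed

lemma distribution_zero: "distribution (\<lambda>\<phi>. 0)"
  unfolding distribution_def by (auto simp: linear_iff intro!: exI[of _ 0])

lemma distribution_add:
  assumes "distribution S" "distribution T" shows "distribution (\<lambda>\<phi>. S \<phi> + T \<phi>)"
  unfolding distribution_def
proof (intro conjI allI impI)
  show "linear (\<lambda>\<phi>. S \<phi> + T \<phi>)"
    using assms by (auto simp: distribution_def intro: linear_compose_add)
  fix K :: "(real^'a) set" assume K: "compact K"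
  obtain C N where 1: "\<And>\<phi>. {x. test_apply \<phi> x \<noteq> 0} \<subseteq> K \<Longrightarrow> \<bar>S \<phi>\<bar> \<le> C * test_seminorm N \<phi>"
    using assms(1) K unfolding distribution_def by blast
  obtain D M where 2: "\<And>\<phi>. {x. test_apply \<phi> x \<noteq> 0} \<subseteq> K \<Longrightarrow> \<bar>T \<phi>\<bar> \<le> D * test_seminorm M \<phi>"
    using assms(2) K unfolding distribution_def by blast
  have "\<bar>S \<phi> + T \<phi>\<bar> \<le> (\<bar>C\<bar> + \<bar>D\<bar>) * test_seminorm (max N M) \<phi>"
    if \<phi>: "{x. test_apply \<phi> x \<noteq> 0} \<subseteq> K" for \<phi>
  proof -
    have "C * test_seminorm N \<phi> \<le> \<bar>C\<bar> * test_seminorm (max N M) \<phi>"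
      by (intro mult_mono test_seminorm_mono test_seminorm_nonneg) auto
    moreover have "D * test_seminorm M \<phi> \<le> \<bar>D\<bar> * test_seminorm (max N M) \<phi>"
      by (intro mult_mono test_seminorm_mono test_seminorm_nonneg) auto
    ultimately show ?thesis using 1[OF \<phi>] 2[OF \<phi>] unfolding distrib_right by linarith
  qed
  thus "\<exists>C N. \<forall>\<phi>. {x. test_apply \<phi> x \<noteq> 0} \<subseteq> K \<longrightarrow> \<bar>S \<phi> + T \<phi>\<bar> \<le> C * test_seminorm N \<phi>"
    by blast
qed

lemma distribution_cmult:
  assumes "distribution T" shows "distribution (\<lambda>\<phi>. c * T \<phi>)"
  unfolding distribution_def
proof (intro conjI allI impI)
  show "linear (\<lambda>\<phi>. c * T \<phi>)"
    using assms linear_compose_scale_right[of T c] by (auto simp: distribution_def)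
  fix K :: "(real^'a) set" assume K: "compact K"
  obtain C N where 1: "\<And>\<phi>. {x. test_apply \<phi> x \<noteq> 0} \<subseteq> K \<Longrightarrow> \<bar>T \<phi>\<bar> \<le> C * test_seminorm N \<phi>"
    using assms(1) K unfolding distribution_def by blast
  have "\<bar>c * T \<phi>\<bar> \<le> (\<bar>c\<bar> * C) * test_seminorm N \<phi>" if "{x. test_apply \<phi> x \<noteq> 0} \<subseteq> K" for \<phi>
    using mult_left_mono[OF 1[OF that], of "\<bar>c\<bar>"] by (simp add: abs_mult mult.assoc)
  thus "\<exists>C N. \<forall>\<phi>. {x. test_apply \<phi> x \<noteq> 0} \<subseteq> K \<longrightarrow> \<bar>c * T \<phi>\<bar> \<le> C * test_seminorm N \<phi>"
    by blast
qed

lemma linear_test_pderiv: "linear (test_pderiv i)"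
proof (rule linearI)
  show "test_pderiv i (f + g) = test_pderiv i f + test_pderiv i g" for f g
    by transfer (simp add: pderiv_at_add test_function_def)
  show "test_pderiv i (r *\<^sub>R f) = r *\<^sub>R test_pderiv i f" for r f
    by transfer (simp add: pderiv_at_cmult test_function_def)
qed

lemma distribution_pderiv:
  assumes "distribution T" shows "distribution (\<lambda>\<phi>. - T (test_pderiv i \<phi>))"
  unfolding distribution_def
proof (intro conjI allI impI)
  have "linear T" using assms by (simp add: distribution_def)
  hence "linear (T \<circ> test_pderiv i)" using linear_compose[OF linear_test_pderiv] by blast
  thus "linear (\<lambda>\<phi>. - T (test_pderiv i \<phi>))"
    using linear_compose_neg by (auto simp: o_def)
  fix K :: "(real^'a) set" assume K: "compact K"
  obtain C N where 1: "\<And>\<phi>. {x. test_apply \<phi> x \<noteq> 0} \<subseteq> K \<Longrightarrow> \<bar>T \<phi>\<bar> \<le> C * test_seminorm N \<phi>"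
    using assms(1) K unfolding distribution_def by blast
  have "\<bar>- T (test_pderiv i \<phi>)\<bar> \<le> \<bar>C\<bar> * test_seminorm (Suc N) \<phi>"
    if \<phi>: "{x. test_apply \<phi> x \<noteq> 0} \<subseteq> K" for \<phi>
  proof -
    have "closure {x. test_apply \<phi> x \<noteq> 0} \<subseteq> K"
      using \<phi> K by (simp add: closure_minimal compact_imp_closed)
    hence "{x. test_apply (test_pderiv i \<phi>) x \<noteq> 0} \<subseteq> K"
      using pderiv_support[of i "test_apply \<phi>"] by (auto simp: test_pderiv.rep_eq)
    from 1[OF this] have "\<bar>T (test_pderiv i \<phi>)\<bar> \<le> C * test_seminorm N (test_pderiv i \<phi>)" .
    also have "\<dots> \<le> \<bar>C\<bar> * test_seminorm (Suc N) \<phi>"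
      by (intro mult_mono test_seminorm_pderiv test_seminorm_nonneg) auto
    finally show ?thesis by simp
  qed
  thus "\<exists>C N. \<forall>\<phi>. {x. test_apply \<phi> x \<noteq> 0} \<subseteq> K \<longrightarrow> \<bar>- T (test_pderiv i \<phi>)\<bar> \<le> C * test_seminorm N \<phi>"
    by blast
qed

lemma distribution_dirac: "distribution (\<lambda>\<phi>. test_apply \<phi> 0)"
  unfolding distribution_def
proof (intro conjI allI impI)
  show "linear (\<lambda>\<phi>. test_apply \<phi> 0 :: real)"
    by (rule linearI) (simp_all add: plus_test.rep_eq scaleR_test.rep_eq)
  have "\<bar>test_apply \<phi> 0\<bar> \<le> 1 * test_seminorm 0 \<phi>" for \<phi> :: "'a test"
    using cSUP_upper[OF UNIV_I test_function_bdd[OF test_fold_pderiv[of "[]" \<phi>]], of 0]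
    by (simp add: test_seminorm_def)
  thus "\<exists>C N. \<forall>\<phi>::'a test. {x. test_apply \<phi> x \<noteq> 0} \<subseteq> K \<longrightarrow> \<bar>test_apply \<phi> 0\<bar> \<le> C * test_seminorm N \<phi>" for K
    by blast
qed

typedef (overloaded) 'm distr = "{T :: 'm::finite test \<Rightarrow> real. distribution T}"
  morphisms distr_apply Abs_distr
  using distribution_zero by blast

setup_lifting type_definition_distr

instantiation distr :: (finite) real_vector
begin

lift_definition zero_distr :: "'a distr" is "\<lambda>\<phi>. 0"
  by (rule distribution_zero)
lift_definition plus_distr :: "'a distr \<Rightarrow> 'a distr \<Rightarrow> 'a distr" is "\<lambda>S T \<phi>. S \<phi> + T \<phi>"
  by (rule distribution_add)
lift_definition scaleR_distr :: "real \<Rightarrow> 'a distr \<Rightarrow> 'a distr" is "\<lambda>c T \<phi>. c * T \<phi>"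
  by (rule distribution_cmult)
definition uminus_distr :: "'a distr \<Rightarrow> 'a distr" where "uminus_distr T = (-1) *\<^sub>R T"
definition minus_distr :: "'a distr \<Rightarrow> 'a distr \<Rightarrow> 'a distr" where "minus_distr S T = S + (-1) *\<^sub>R T"

instance
proof
  fix a b c :: "'a distr" and r s :: real
  show "a + b + c = a + (b + c)" by transfer (simp add: add.assoc)
  show "a + b = b + a" by transfer (simp add: add.commute)
  show "0 + a = a" by transfer simp
  show "- a + a = 0" unfolding uminus_distr_def by transfer simp
  show "a - b = a + - b" by (simp add: uminus_distr_def minus_distr_def)
  show "r *\<^sub>R (a + b) = r *\<^sub>R a + r *\<^sub>R b" by transfer (simp add: distrib_left)
  show "(r + s) *\<^sub>R a = r *\<^sub>R a + s *\<^sub>R a" by transfer (simp add: distrib_right)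
  show "r *\<^sub>R s *\<^sub>R a = (r * s) *\<^sub>R a" by transfer (simp add: mult.assoc)
  show "1 *\<^sub>R a = a" by transfer simp
qed

end

lift_definition distr_pderiv :: "'m::finite \<Rightarrow> 'm distr \<Rightarrow> 'm distr"
  is "\<lambda>i T \<phi>. - T (test_pderiv i \<phi>)"
  by (rule distribution_pderiv)

lift_definition dirac :: "'m::finite distr" is "\<lambda>\<phi>. test_apply \<phi> 0"
  by (rule distribution_dirac)

definition laplace_b :: "'m::finite distr \<Rightarrow> 'm distr" where
  "laplace_b T = - (\<Sum>j\<in>UNIV. distr_pderiv j (distr_pderiv j T))"


section \<open>The algebra of super variables, by generators and relations\<close>

text \<open>
  \<open>X j\<close> stands for the anticommuting variable with index \<open>j\<close>, \<open>E i\<close> for the orthogonal Clifford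
  generator \<open>e\<^sub>i\<close>, and \<open>W j\<close> for the symplectic (Weyl) generator with index \<open>j\<close>.
\<close>

datatype 'm gen = X nat | E 'm | W nat

datatype 'a word = Word "'a list"

instantiation word :: (type) monoid_add
begin

definition zero_word :: "'a word" where "zero_word = Word []"
fun plus_word :: "'a word \<Rightarrow> 'a word \<Rightarrow> 'a word" where
  "plus_word (Word u) (Word v) = Word (u @ v)"

instance
proof
  fix a b c :: "'a word"
  show "a + b + c = a + (b + c)" by (cases a; cases b; cases c) simp
  show "0 + a = a" "a + 0 = a" by (cases a; simp add: zero_word_def)+
qed

end

text \<open>
  The free real algebra on the generators: its elements are finite real combinations of words,
  and its product (convolution) concatenates words.
\<close>

type_synonym 'm free_alg = "'m gen word \<Rightarrow>\<^sub>0 real"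

definition gen :: "'m gen \<Rightarrow> 'm free_alg" where
  "gen a = Poly_Mapping.single (Word [a]) 1"

text \<open>
  The generators \<open>X j\<close> and \<open>W j\<close> with an index outside \<open>{1..2 * n}\<close> do not exist in the algebra
  \<open>\<Lambda>\<^sub>2\<^sub>n \<otimes> C\<close>; the last clause removes them, so that the free algebra need not depend on \<open>n\<close>.
\<close>

definition relators :: "nat \<Rightarrow> 'm free_alg set" where
  "relators n =
     {gen (X j) * gen (X k) + gen (X k) * gen (X j) | j k. j \<in> {1..2*n} \<and> k \<in> {1..2*n}} \<union>
     {gen (E j) * gen (E k) + gen (E k) * gen (E j) + 2 * of_bool (j = k) | j k. True} \<union>
     {gen (W (2*j)) * gen (W (2*k)) - gen (W (2*k)) * gen (W (2*j)) | j k.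
        j \<in> {1..n} \<and> k \<in> {1..n}} \<union>
     {gen (W (2*j-1)) * gen (W (2*k-1)) - gen (W (2*k-1)) * gen (W (2*j-1)) | j k.
        j \<in> {1..n} \<and> k \<in> {1..n}} \<union>
     {gen (W (2*j-1)) * gen (W (2*k)) - gen (W (2*k)) * gen (W (2*j-1)) - of_bool (j = k) | j k.
        j \<in> {1..n} \<and> k \<in> {1..n}} \<union>
     {gen (E j) * gen (W k) + gen (W k) * gen (E j) | j k. k \<in> {1..2*n}} \<union>
     {gen (E j) * gen (X k) - gen (X k) * gen (E j) | j k. k \<in> {1..2*n}} \<union>
     {gen (W j) * gen (X k) - gen (X k) * gen (W j) | j k. j \<in> {1..2*n} \<and> k \<in> {1..2*n}} \<union>
     {a. \<exists>j. j \<notin> {1..2*n} \<and> (a = gen (X j) \<or> a = gen (W j))}"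

inductive_set relation_ideal :: "nat \<Rightarrow> 'm free_alg set" for n where
  zero: "0 \<in> relation_ideal n"
| add: "a \<in> relation_ideal n \<Longrightarrow> b \<in> relation_ideal n \<Longrightarrow> a + b \<in> relation_ideal n"
| relator: "r \<in> relators n \<Longrightarrow> a * r * b \<in> relation_ideal n"


section \<open>Super distributions\<close>

text \<open>
  Elements of \<open>D'(\<real>\<^sup>m) \<otimes> \<Lambda>\<^sub>2\<^sub>n \<otimes> C\<close> are given by representatives in the tensor product of
  \<open>D'(\<real>\<^sup>m)\<close> with the free algebra, i.e. by finite combinations of words with distributional
  coefficients.  As \<open>\<Lambda>\<^sub>2\<^sub>n \<otimes> C\<close> is the free algebra modulo \<open>relation_ideal n\<close>, two representatives
  give the same element iff their difference lies in \<open>D'(\<real>\<^sup>m) \<otimes> relation_ideal n\<close>.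
\<close>

type_synonym 'm superdistr = "'m gen word \<Rightarrow>\<^sub>0 'm distr"

definition tensor :: "'m::finite distr \<Rightarrow> 'm free_alg \<Rightarrow> 'm superdistr" (infixr \<open>\<otimes>\<^sub>D\<close> 72) where
  "T \<otimes>\<^sub>D a = Poly_Mapping.map (\<lambda>c. c *\<^sub>R T) a"

definition super_null :: "nat \<Rightarrow> 'm::finite superdistr set" where
  "super_null n = {\<Sum>i<N. T i \<otimes>\<^sub>D r i | (N::nat) T r. \<forall>i<N. r i \<in> relation_ideal n}"

definition super_eq :: "nat \<Rightarrow> 'm::finite superdistr \<Rightarrow> 'm superdistr \<Rightarrow> bool" where
  "super_eq n u v \<longleftrightarrow> u - v \<in> super_null n"

definition super_scale :: "real \<Rightarrow> 'm::finite superdistr \<Rightarrow> 'm superdistr" where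
  "super_scale c u = Poly_Mapping.map (\<lambda>T. c *\<^sub>R T) u"

text \<open>
  The left derivative with respect to \<open>X j\<close>, first on words: it obeys the graded Leibniz rule
  with respect to the \<open>X k\<close> and commutes with left multiplication by the \<open>E i\<close> and \<open>W k\<close>.
\<close>

fun left_deriv_word :: "nat \<Rightarrow> 'm gen list \<Rightarrow> 'm free_alg" where
  "left_deriv_word j [] = 0"
| "left_deriv_word j (X k # w) =
     of_bool (j = k) * Poly_Mapping.single (Word w) 1 - gen (X k) * left_deriv_word j w"
| "left_deriv_word j (E i # w) = gen (E i) * left_deriv_word j w"
| "left_deriv_word j (W k # w) = gen (W k) * left_deriv_word j w"

definition left_deriv :: "nat \<Rightarrow> 'm::finite superdistr \<Rightarrow> 'm superdistr" where
  "left_deriv j u = (\<Sum>w\<in>Poly_Mapping.keys u.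
     Poly_Mapping.lookup u w \<otimes>\<^sub>D (case w of Word l \<Rightarrow> left_deriv_word j l))"

definition super_pderiv :: "'m::finite \<Rightarrow> 'm superdistr \<Rightarrow> 'm superdistr" where
  "super_pderiv j u = Poly_Mapping.map (distr_pderiv j) u"

definition super_laplace_b :: "'m::finite superdistr \<Rightarrow> 'm superdistr" where
  "super_laplace_b u = - (\<Sum>j\<in>UNIV. super_pderiv j (super_pderiv j u))"

definition super_laplace_f :: "nat \<Rightarrow> 'm::finite superdistr \<Rightarrow> 'm superdistr" where
  "super_laplace_f n u =
     super_scale 4 (\<Sum>j=1..n. left_deriv (2*j-1) (left_deriv (2*j) u))"

definition super_laplace :: "nat \<Rightarrow> 'm::finite superdistr \<Rightarrow> 'm superdistr" where
  "super_laplace n u = super_laplace_b u + super_laplace_f n u"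

definition xgrave :: "nat \<Rightarrow> 'm free_alg" where
  "xgrave n = (\<Sum>j=1..2*n. gen (X j) * gen (W j))"

definition super_dirac :: "nat \<Rightarrow> 'm::finite superdistr" where
  "super_dirac n = dirac \<otimes>\<^sub>D prod_list (map (\<lambda>j. gen (X j)) [1..<2*n+1])"

definition super_fundamental_solution :: "nat \<Rightarrow> 'm::finite superdistr \<Rightarrow> bool" where
  "super_fundamental_solution n u \<longleftrightarrow> super_eq n (super_laplace n u) (super_dirac n)"

definition super_nu :: "nat \<Rightarrow> (nat \<Rightarrow> 'm::finite distr) \<Rightarrow> 'm superdistr" where
  "super_nu n \<nu> = (\<Sum>k=0..n.
     super_scale (4 ^ k * fact k / fact (n - k)) (\<nu> (2*k+2) \<otimes>\<^sub>D xgrave n ^ (2*n - 2*k)))"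

section \<open>The super Laplace operator is compatible with the relations\<close>

lemma lookup_tensor: "Poly_Mapping.lookup (T \<otimes>\<^sub>D a) w = Poly_Mapping.lookup a w *\<^sub>R T"
  by (simp add: tensor_def Poly_Mapping.map.rep_eq when_def)

lemma lookup_super_scale: "Poly_Mapping.lookup (super_scale c u) w = c *\<^sub>R Poly_Mapping.lookup u w"
  by (simp add: super_scale_def Poly_Mapping.map.rep_eq when_def)

lemma tensor_add_right: "T \<otimes>\<^sub>D (a + b) = T \<otimes>\<^sub>D a + T \<otimes>\<^sub>D b"
  by (rule poly_mapping_eqI) (simp add: lookup_tensor lookup_add scaleR_add_left)

lemma tensor_add_left: "(S + T) \<otimes>\<^sub>D a = S \<otimes>\<^sub>D a + T \<otimes>\<^sub>D a"
  by (rule poly_mapping_eqI) (simp add: lookup_tensor lookup_add scaleR_add_right)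

lemma tensor_zero_left [simp]: "0 \<otimes>\<^sub>D a = 0"
  by (rule poly_mapping_eqI) (simp add: lookup_tensor)

lemma tensor_zero_right [simp]: "T \<otimes>\<^sub>D 0 = 0"
  by (rule poly_mapping_eqI) (simp add: lookup_tensor)

lemma tensor_sum_right: "T \<otimes>\<^sub>D sum f A = (\<Sum>x\<in>A. T \<otimes>\<^sub>D f x)"
  by (induction A rule: infinite_finite_induct) (simp_all add: tensor_add_right)

definition word_deriv :: "nat \<Rightarrow> 'm gen word \<Rightarrow> 'm free_alg" where
  "word_deriv j w = (case w of Word l \<Rightarrow> left_deriv_word j l)"

definition free_deriv :: "nat \<Rightarrow> 'm free_alg \<Rightarrow> 'm free_alg" where
  "free_deriv j a =
     (\<Sum>w\<in>Poly_Mapping.keys a. Poly_Mapping.single 0 (Poly_Mapping.lookup a w) * word_deriv j w)"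

lemma left_deriv_superset:
  assumes "finite A" "Poly_Mapping.keys u \<subseteq> A"
  shows "left_deriv j u = (\<Sum>w\<in>A. Poly_Mapping.lookup u w \<otimes>\<^sub>D word_deriv j w)"
  unfolding left_deriv_def word_deriv_def using assms
  by (intro sum.mono_neutral_left) (auto simp: in_keys_iff)

lemma free_deriv_superset:
  assumes "finite A" "Poly_Mapping.keys u \<subseteq> A"
  shows "free_deriv j u = (\<Sum>w\<in>A. Poly_Mapping.single 0 (Poly_Mapping.lookup u w) * word_deriv j w)"
  unfolding free_deriv_def using assms
  by (intro sum.mono_neutral_left) (auto simp: in_keys_iff)

lemma left_deriv_add: "left_deriv j (u + v) = left_deriv j u + left_deriv j v"
proof -
  let ?A = "Poly_Mapping.keys u \<union> Poly_Mapping.keys v"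
  have "Poly_Mapping.keys (u + v) \<subseteq> ?A" by (rule Poly_Mapping.keys_add)
  thus ?thesis
    by (simp add: left_deriv_superset[of ?A] lookup_add tensor_add_left sum.distrib)
qed

lemma free_deriv_add: "free_deriv j (a + b) = free_deriv j a + free_deriv j b"
proof -
  let ?A = "Poly_Mapping.keys a \<union> Poly_Mapping.keys b"
  have "Poly_Mapping.keys (a + b) \<subseteq> ?A" by (rule Poly_Mapping.keys_add)
  thus ?thesis
    by (simp add: free_deriv_superset[of ?A] lookup_add single_add distrib_right sum.distrib)
qed

lemma free_deriv_zero [simp]: "free_deriv j 0 = 0"
  by (simp add: free_deriv_def)

lemma free_deriv_uminus: "free_deriv j (- a) = - free_deriv j a"
  using free_deriv_add[of j a "- a"] by (simp add: eq_neg_iff_add_eq_0 add.commute)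

lemma free_deriv_diff: "free_deriv j (a - b) = free_deriv j a - free_deriv j b"
  using free_deriv_add[of j a "- b"] by (simp add: free_deriv_uminus)

lemma left_deriv_sum: "left_deriv j (sum f A) = (\<Sum>x\<in>A. left_deriv j (f x))"
  by (induction A rule: infinite_finite_induct) (simp_all add: left_deriv_add left_deriv_def[of j 0])

lemma free_deriv_sum: "free_deriv j (sum f A) = (\<Sum>x\<in>A. free_deriv j (f x))"
  by (induction A rule: infinite_finite_induct) (simp_all add: free_deriv_add)

lemma lookup_single_zero_mult:
  "Poly_Mapping.lookup (Poly_Mapping.single 0 c * a) w = c * Poly_Mapping.lookup (a :: 'm free_alg) w"
  by (simp add: mult_map_scale_conv_mult[symmetric] Poly_Mapping.map.rep_eq when_def)

lemma free_alg_sum_single: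
  "a = (\<Sum>w\<in>Poly_Mapping.keys a. Poly_Mapping.single w (Poly_Mapping.lookup a w))"
  for a :: "'m free_alg"
  by (rule poly_mapping_eqI) (simp add: lookup_sum lookup_single when_def in_keys_iff)

lemma single_zero_commute:
  "Poly_Mapping.single 0 c * a = a * Poly_Mapping.single 0 (c :: real)" for a :: "'m free_alg"
proof -
  let ?a = "\<Sum>w\<in>Poly_Mapping.keys a. Poly_Mapping.single w (Poly_Mapping.lookup a w)"
  have "Poly_Mapping.single 0 c * ?a = ?a * Poly_Mapping.single 0 c"
    by (simp add: sum_distrib_left sum_distrib_right mult_single mult.commute)
  thus ?thesis by (simp only: free_alg_sum_single[of a, symmetric])
qed

lemma left_deriv_tensor: "left_deriv j (T \<otimes>\<^sub>D a) = T \<otimes>\<^sub>D free_deriv j a"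
proof -
  have sub: "Poly_Mapping.keys (T \<otimes>\<^sub>D a) \<subseteq> Poly_Mapping.keys a"
    by (auto simp: in_keys_iff lookup_tensor)
  have "(c *\<^sub>R T) \<otimes>\<^sub>D d = T \<otimes>\<^sub>D (Poly_Mapping.single 0 c * d)" for c d
    by (rule poly_mapping_eqI)
       (simp add: lookup_tensor lookup_single_zero_mult mult.commute)
  thus ?thesis
    by (simp add: left_deriv_superset[OF _ sub] free_deriv_def lookup_tensor tensor_sum_right)
qed

lemma free_deriv_single:
  "free_deriv j (Poly_Mapping.single w c) = Poly_Mapping.single 0 c * word_deriv j w"
  by (simp add: free_deriv_superset[of "{w}"])

lemma free_deriv_gen_mult:
  "free_deriv j (gen g * a) =
     (case g of X k \<Rightarrow> of_bool (j = k) * a - gen (X k) * free_deriv j a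
      | _ \<Rightarrow> gen g * free_deriv j a)"
proof -
  let ?f = "\<lambda>a. case g of X k \<Rightarrow> of_bool (j = k) * a - gen (X k) * free_deriv j a
      | _ \<Rightarrow> gen g * free_deriv j a"
  have single: "free_deriv j (gen g * Poly_Mapping.single w c) = ?f (Poly_Mapping.single w c)" for w c
  proof (cases w)
    case (Word l)
    let ?c = "Poly_Mapping.single 0 c"
    have sc: "Poly_Mapping.single w c = ?c * Poly_Mapping.single (Word l) 1"
      by (simp add: mult_single Word)
    have "gen g * Poly_Mapping.single w c = Poly_Mapping.single (Word (g # l)) c"
      by (simp add: gen_def mult_single Word)
    hence "free_deriv j (gen g * Poly_Mapping.single w c) = ?c * left_deriv_word j (g # l)"
      by (simp add: free_deriv_single word_deriv_def)
    also have "\<dots> = ?f (Poly_Mapping.single w c)"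
    proof -
      have swap: "?c * (gen h * y) = gen h * (?c * y)" for h y
        by (metis mult.assoc single_zero_commute)
      have D: "free_deriv j (Poly_Mapping.single w c) = ?c * left_deriv_word j l"
        by (simp add: free_deriv_single word_deriv_def Word)
      show ?thesis
        unfolding D by (cases g) (simp_all add: sc right_diff_distrib swap)
    qed
    finally show ?thesis .
  qed
  have "free_deriv j (gen g * a) =
      (\<Sum>w\<in>Poly_Mapping.keys a. ?f (Poly_Mapping.single w (Poly_Mapping.lookup a w)))"
    by (subst free_alg_sum_single[of a]) (simp add: sum_distrib_left free_deriv_sum single)
  also have "\<dots> = ?f (\<Sum>w\<in>Poly_Mapping.keys a. Poly_Mapping.single w (Poly_Mapping.lookup a w))"
    by (cases g) (simp_all add: sum_distrib_left free_deriv_sum sum_subtractf)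
  also have "\<dots> = ?f a" by (simp only: free_alg_sum_single[of a, symmetric])
  finally show ?thesis .
qed

lemma relation_ideal_mult_left: "a \<in> relation_ideal n \<Longrightarrow> c * a \<in> relation_ideal n"
proof (induction a rule: relation_ideal.induct)
  case (relator r a b)
  from relation_ideal.relator[OF this, of "c * a" b] show ?case by (simp add: mult.assoc)
qed (auto intro: relation_ideal.intros simp: distrib_left)

lemma relation_ideal_uminus: "a \<in> relation_ideal n \<Longrightarrow> - a \<in> relation_ideal n"
  using relation_ideal_mult_left[of a n "-1"] by simp

lemma relation_ideal_diff:
  "a \<in> relation_ideal n \<Longrightarrow> b \<in> relation_ideal n \<Longrightarrow> a - b \<in> relation_ideal n"
  using relation_ideal.add[of a n "- b"] relation_ideal_uminus[of b n] by simp

lemma relation_ideal_sum: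
  "(\<And>x. x \<in> A \<Longrightarrow> f x \<in> relation_ideal n) \<Longrightarrow> sum f A \<in> relation_ideal n"
  by (induction A rule: infinite_finite_induct) (auto intro: relation_ideal.intros)

lemma relator_deriv:
  assumes "r \<in> relators n" "i \<in> {1..2*n}"
  shows "free_deriv i (r * b) = r * free_deriv i b \<or> free_deriv i (r * b) = - (r * free_deriv i b)"
  using assms(1) unfolding relators_def
proof (elim UnE CollectE exE conjE)
  have X: "free_deriv i (gen (X k) * y) = of_bool (i = k) * y - gen (X k) * free_deriv i y"
    and E: "free_deriv i (gen (E l) * y) = gen (E l) * free_deriv i y"
    and W: "free_deriv i (gen (W k) * y) = gen (W k) * free_deriv i y" for i k l and y :: "'a free_alg"
    by (simp_all add: free_deriv_gen_mult)
  note D = X E W mult.assoc free_deriv_add free_deriv_diff distrib_right left_diff_distrib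
    distrib_left right_diff_distrib mult_2
  show ?thesis if "r = gen (X j) * gen (X k) + gen (X k) * gen (X j)" for j k
    by (rule disjI1, cases "i = j"; cases "i = k") (simp_all add: that D)
  show ?thesis if "r = gen (E j) * gen (E k) + gen (E k) * gen (E j) + 2 * of_bool (j = k)" for j k
    by (rule disjI1, cases "j = k") (simp_all add: that D)
  show ?thesis if "r = gen (W (2*j)) * gen (W (2*k)) - gen (W (2*k)) * gen (W (2*j))" for j k
    by (rule disjI1) (simp add: that D)
  show ?thesis if "r = gen (W (2*j-1)) * gen (W (2*k-1)) - gen (W (2*k-1)) * gen (W (2*j-1))" for j k
    by (rule disjI1) (simp add: that D)
  show ?thesis if "r = gen (W (2*j-1)) * gen (W (2*k)) - gen (W (2*k)) * gen (W (2*j-1)) - of_bool (j = k)" for j k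
    by (rule disjI1, cases "j = k") (simp_all add: that D)
  show ?thesis if "r = gen (E j) * gen (W k) + gen (W k) * gen (E j)" for j k
    by (rule disjI1) (simp add: that D)
  show ?thesis if "r = gen (E j) * gen (X k) - gen (X k) * gen (E j)" for j k
    by (rule disjI2, cases "i = k") (simp_all add: that D)
  show ?thesis if "r = gen (W j) * gen (X k) - gen (X k) * gen (W j)" for j k
    by (rule disjI2, cases "i = k") (simp_all add: that D)
  show ?thesis if "j \<notin> {1..2*n}" "r = gen (X j) \<or> r = gen (W j)" for j
  proof -
    from that(1) assms(2) have "i \<noteq> j" by auto
    with that(2) show ?thesis by (auto simp: X W)
  qed
qed

lemma free_deriv_relation_ideal:
  assumes "i \<in> {1..2*n}" "a \<in> relation_ideal n"
  shows "free_deriv i a \<in> relation_ideal n"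
  using assms(2)
proof induction
  case (relator r a b)
  have rb: "a * r * b \<in> relation_ideal n" for a b by (rule relation_ideal.relator[OF relator])
  have rb1: "r * b \<in> relation_ideal n" for b using rb[of 1] by simp
  have gen: "free_deriv i (gen g * y) \<in> relation_ideal n"
    if "y \<in> relation_ideal n" "free_deriv i y \<in> relation_ideal n" for g y
    using that by (cases g)
      (auto simp: free_deriv_gen_mult of_bool_def intro: relation_ideal_diff relation_ideal_mult_left
         relation_ideal_uminus)
  have word: "free_deriv i (Poly_Mapping.single (Word l) 1 * y) \<in> relation_ideal n"
    if "y \<in> relation_ideal n" "free_deriv i y \<in> relation_ideal n" for l y
  proof (induction l)
    case Nil
    thus ?case using that by (simp add: zero_word_def[symmetric])
  next
    case (Cons g l)
    have "Poly_Mapping.single (Word (g # l)) 1 * y = gen g * (Poly_Mapping.single (Word l) 1 * y)"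
      by (simp add: gen_def mult.assoc[symmetric] mult_single)
    thus ?case using gen[OF relation_ideal_mult_left[OF that(1)] Cons] by simp
  qed
  have summand: "free_deriv i (Poly_Mapping.single w c * (r * b)) \<in> relation_ideal n" for w c
  proof -
    let ?y = "r * (Poly_Mapping.single 0 c * b)"
    obtain l where l: "w = Word l" by (cases w)
    have "free_deriv i ?y \<in> relation_ideal n"
      using relator_deriv[OF relator assms(1)] rb1 relation_ideal_uminus by metis
    moreover have "Poly_Mapping.single w c * (r * b) = Poly_Mapping.single (Word l) 1 * ?y"
    proof -
      have "Poly_Mapping.single w c * (r * b)
          = Poly_Mapping.single w 1 * ((Poly_Mapping.single 0 c * r) * b)"
        by (simp add: mult.assoc[symmetric] mult_single)
      also have "\<dots> = Poly_Mapping.single w 1 * ?y"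
        by (simp only: single_zero_commute[of c r] mult.assoc)
      finally show ?thesis by (simp only: l)
    qed
    ultimately show ?thesis using word[OF rb1] by simp
  qed
  have "free_deriv i ((\<Sum>w\<in>Poly_Mapping.keys a. Poly_Mapping.single w (Poly_Mapping.lookup a w)) * (r * b))
      \<in> relation_ideal n"
    unfolding sum_distrib_right free_deriv_sum by (intro relation_ideal_sum summand)
  thus ?case by (simp only: free_alg_sum_single[of a, symmetric] mult.assoc)
qed (auto simp: free_deriv_add intro: relation_ideal.intros)

lemma super_null_tensor: "r \<in> relation_ideal n \<Longrightarrow> T \<otimes>\<^sub>D r \<in> super_null n"
  unfolding super_null_def by (auto intro!: exI[of _ 1] exI[of _ "\<lambda>_. T"] exI[of _ "\<lambda>_. r"])

lemma super_null_zero: "0 \<in> super_null n"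
  unfolding super_null_def by (auto intro!: exI[of _ 0])

lemma super_null_add:
  assumes "u \<in> super_null n" "v \<in> super_null n" shows "u + v \<in> super_null n"
proof -
  obtain N T r where u: "u = (\<Sum>i<N. T i \<otimes>\<^sub>D r i)" and r: "\<forall>i<(N::nat). r i \<in> relation_ideal n"
    using assms(1) by (auto simp: super_null_def)
  obtain M S s where v: "v = (\<Sum>i<M. S i \<otimes>\<^sub>D s i)" and s: "\<forall>i<(M::nat). s i \<in> relation_ideal n"
    using assms(2) by (auto simp: super_null_def)
  have "u + (\<Sum>i<k. S i \<otimes>\<^sub>D s i) \<in> super_null n" if "k \<le> M" for k
    using that
  proof (induction k)
    case 0 thus ?case using assms by simp
  next
    case (Suc k)
    then obtain K P p where w: "u + (\<Sum>i<k. S i \<otimes>\<^sub>D s i) = (\<Sum>i<K. P i \<otimes>\<^sub>D p i)"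
      and p: "\<forall>i<(K::nat). p i \<in> relation_ideal n"
      by (auto simp: super_null_def)
    let ?P = "P(K := S k)" and ?p = "p(K := s k)"
    have "(\<Sum>i<Suc K. ?P i \<otimes>\<^sub>D ?p i) = u + (\<Sum>i<Suc k. S i \<otimes>\<^sub>D s i)"
      by (simp add: w[symmetric] add.assoc)
    moreover have "\<forall>i<Suc K. ?p i \<in> relation_ideal n" using p s Suc.prems by auto
    ultimately show ?case unfolding super_null_def mem_Collect_eq
      by (intro exI[of _ "Suc K"] exI[of _ ?P] exI[of _ ?p]) simp
  qed
  from this[of M] show ?thesis by (simp add: v)
qed

lemma super_null_sum: "(\<And>x. x \<in> A \<Longrightarrow> f x \<in> super_null n) \<Longrightarrow> sum f A \<in> super_null n"
  by (induction A rule: infinite_finite_induct) (auto intro: super_null_zero super_null_add)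

lemma super_null_hom:
  assumes "u \<in> super_null n" and hom: "\<And>f (N::nat). F (sum f {..<N}) = (\<Sum>i<N. F (f i))"
    and F: "\<And>T r. r \<in> relation_ideal n \<Longrightarrow> F (T \<otimes>\<^sub>D r) \<in> super_null n"
  shows "F u \<in> super_null n"
proof -
  obtain N T r where u: "u = (\<Sum>i<N. T i \<otimes>\<^sub>D r i)" and r: "\<forall>i<(N::nat). r i \<in> relation_ideal n"
    using assms(1) by (auto simp: super_null_def)
  show ?thesis unfolding u hom by (intro super_null_sum F) (use r in auto)
qed

lemma left_deriv_super_null:
  assumes "j \<in> {1..2*n}" "u \<in> super_null n" shows "left_deriv j u \<in> super_null n"
  by (rule super_null_hom[OF assms(2)])
     (auto simp: left_deriv_sum left_deriv_tensor intro: super_null_tensor free_deriv_relation_ideal[OF assms(1)])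

lemma linear_distr_pderiv: "linear (distr_pderiv i)"
proof (rule linearI)
  show "distr_pderiv i (S + T) = distr_pderiv i S + distr_pderiv i T" for S T
    by transfer (simp add: fun_eq_iff)
  show "distr_pderiv i (c *\<^sub>R T) = c *\<^sub>R distr_pderiv i T" for c T
    by transfer (simp add: fun_eq_iff)
qed

lemma lookup_super_pderiv:
  "Poly_Mapping.lookup (super_pderiv i u) w = distr_pderiv i (Poly_Mapping.lookup u w)"
  by (simp add: super_pderiv_def Poly_Mapping.map.rep_eq when_def linear_0[OF linear_distr_pderiv])

lemma super_pderiv_add: "super_pderiv i (u + v) = super_pderiv i u + super_pderiv i v"
  by (rule poly_mapping_eqI) (simp add: lookup_super_pderiv lookup_add linear_add[OF linear_distr_pderiv])

lemma super_scale_add: "super_scale c (u + v) = super_scale c u + super_scale c v"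
  by (rule poly_mapping_eqI) (simp add: lookup_super_scale lookup_add scaleR_add_right)

lemma super_pderiv_zero [simp]: "super_pderiv i 0 = 0"
  using super_pderiv_add[of i 0 0] by simp

lemma super_scale_zero [simp]: "super_scale c 0 = 0"
  using super_scale_add[of c 0 0] by simp

lemma super_pderiv_sum: "super_pderiv i (sum f A) = (\<Sum>x\<in>A. super_pderiv i (f x))"
  by (induction A rule: infinite_finite_induct) (simp_all add: super_pderiv_add)

lemma super_scale_sum: "super_scale c (sum f A) = (\<Sum>x\<in>A. super_scale c (f x))"
  by (induction A rule: infinite_finite_induct) (simp_all add: super_scale_add)

lemma super_pderiv_tensor: "super_pderiv i (T \<otimes>\<^sub>D a) = distr_pderiv i T \<otimes>\<^sub>D a"
  by (rule poly_mapping_eqI)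
     (simp add: lookup_super_pderiv lookup_tensor linear_scale[OF linear_distr_pderiv])

lemma super_scale_tensor: "super_scale c (T \<otimes>\<^sub>D a) = (c *\<^sub>R T) \<otimes>\<^sub>D a"
  by (rule poly_mapping_eqI) (simp add: lookup_super_scale lookup_tensor)

lemma super_scale_super_null: "u \<in> super_null n \<Longrightarrow> super_scale c u \<in> super_null n"
  by (erule super_null_hom) (auto simp: super_scale_sum super_scale_tensor intro: super_null_tensor)

lemma super_pderiv_super_null: "u \<in> super_null n \<Longrightarrow> super_pderiv i u \<in> super_null n"
  by (erule super_null_hom) (auto simp: super_pderiv_sum super_pderiv_tensor intro: super_null_tensor)

lemma super_scale_minus_one: "super_scale (-1) u = - u"
  by (rule poly_mapping_eqI) (simp add: lookup_super_scale)

lemma super_laplace_super_null: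
  assumes "u \<in> super_null n" shows "super_laplace n u \<in> super_null n"
proof -
  have "super_laplace_b u \<in> super_null n"
    unfolding super_laplace_b_def super_scale_minus_one[symmetric]
    by (intro super_scale_super_null super_null_sum super_pderiv_super_null assms)
  moreover have "super_laplace_f n u \<in> super_null n"
    unfolding super_laplace_f_def
    by (intro super_scale_super_null super_null_sum left_deriv_super_null assms) auto
  ultimately show ?thesis unfolding super_laplace_def by (rule super_null_add)
qed

lemma super_laplace_add: "super_laplace n (u + v) = super_laplace n u + super_laplace n v"
  by (simp add: super_laplace_def super_laplace_b_def super_laplace_f_def super_pderiv_add
        left_deriv_add super_scale_add sum.distrib)

text \<open>Hence the super Laplace operator acts on \<open>D'(\<real>\<^sup>m) \<otimes> \<Lambda>\<^sub>2\<^sub>n \<otimes> C\<close>.\<close>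

lemma super_laplace_cong:
  assumes "super_eq n u v" shows "super_eq n (super_laplace n u) (super_laplace n v)"
proof -
  have "super_laplace n u = super_laplace n (u - v) + super_laplace n v"
    by (simp add: super_laplace_add[symmetric])
  thus ?thesis using super_laplace_super_null[of "u - v" n] assms by (simp add: super_eq_def)
qed

end

theory Submission
  imports Defs
begin

text \<open>
  Modulo the relations \<open>xgrave n ^ 2\<close> is \<open>q = (\<Sum>j=1..n. x\<^sub>2\<^sub>j\<^sub>-\<^sub>1 x\<^sub>2\<^sub>j)\<close>, which commutes with all
  \<open>x\<^sub>i\<close>.  Hence \<open>\<Delta>\<^sub>f q\<^sup>p = - 4 p (n - p + 1) q\<^sup>p\<^sup>-\<^sup>1\<close>, so that the fermionic contribution of each
  summand of \<open>\<nu>\<^sub>2\<close> cancels the bosonic contribution of the next one.  The sum telescopes to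
  \<open>\<delta> q\<^sup>n / n!\<close>, and \<open>q\<^sup>n = n! x\<^sub>1 \<dots> x\<^sub>2\<^sub>n\<close> because the summands of \<open>q\<close> commute and square to zero.
\<close>

section \<open>Congruence modulo the relations\<close>

lemma relation_ideal_mult_right: "a \<in> relation_ideal n \<Longrightarrow> a * c \<in> relation_ideal n"
proof (induction a rule: relation_ideal.induct)
  case (relator r a b)
  from relation_ideal.relator[OF this, of a "b * c"] show ?case by (simp add: mult.assoc)
qed (auto intro: relation_ideal.intros simp: distrib_right)

lemma relator_in_relation_ideal: "r \<in> relators n \<Longrightarrow> r \<in> relation_ideal n"
  using relation_ideal.relator[of r n 1 1] by simp

text \<open>Relators at equal indices, like symmetrised double sums, only yield doubled squares;
  dividing by 2 is multiplication by the scalar \<open>1/2\<close> on the empty word.\<close>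

lemma relation_ideal_halve:
  assumes "a + a \<in> relation_ideal n" shows "a \<in> relation_ideal n"
proof -
  have "Poly_Mapping.single 0 (1/2) * (a + a) = a"
    by (rule poly_mapping_eqI) (simp add: lookup_single_zero_mult lookup_add)
  with relation_ideal_mult_left[OF assms] show ?thesis by metis
qed

context
  fixes n :: nat
begin

text \<open>Equality in the quotient algebra, kept on representatives because a quotient type would
  depend on \<open>n\<close>. Fixing \<open>n\<close> in the context allows infix notation and
  calculational chains.\<close>

definition rel_cong :: "'m free_alg \<Rightarrow> 'm free_alg \<Rightarrow> bool" (infix \<open>\<doteq>\<close> 50) where
  "a \<doteq> b \<longleftrightarrow> a - b \<in> relation_ideal n"

lemma rel_cong_0: "a \<doteq> 0 \<longleftrightarrow> a \<in> relation_ideal n"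
  by (simp add: rel_cong_def)

lemma rel_cong_refl [simp, intro]: "a \<doteq> a"
  by (simp add: rel_cong_def relation_ideal.zero)

lemma rel_cong_sym: "a \<doteq> b \<Longrightarrow> b \<doteq> a"
  using relation_ideal_uminus[of "a - b" n] by (simp add: rel_cong_def)

lemma rel_cong_trans [trans]: "a \<doteq> b \<Longrightarrow> b \<doteq> c \<Longrightarrow> a \<doteq> c"
  using relation_ideal.add[of "a - b" n "b - c"] by (simp add: rel_cong_def)

lemma rel_cong_add: "a \<doteq> b \<Longrightarrow> c \<doteq> d \<Longrightarrow> a + c \<doteq> b + d"
  using relation_ideal.add[of "a - b" n "c - d"] by (simp add: rel_cong_def algebra_simps)

lemma rel_cong_uminus: "a \<doteq> b \<Longrightarrow> - a \<doteq> - b"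
  using relation_ideal_uminus[of "a - b" n] by (simp add: rel_cong_def)

lemma rel_cong_diff: "a \<doteq> b \<Longrightarrow> c \<doteq> d \<Longrightarrow> a - c \<doteq> b - d"
  using rel_cong_add[of a b "- c" "- d"] rel_cong_uminus[of c d] by simp

lemma rel_cong_mult: "a \<doteq> b \<Longrightarrow> c \<doteq> d \<Longrightarrow> a * c \<doteq> b * d"
  using relation_ideal.add[OF relation_ideal_mult_right[of "a - b" n c]
      relation_ideal_mult_left[of "c - d" n b]]
  by (simp add: rel_cong_def algebra_simps)

lemma rel_cong_power: "a \<doteq> b \<Longrightarrow> a ^ k \<doteq> b ^ k"
  by (induction k) (auto intro: rel_cong_mult)

lemma rel_cong_sum: "(\<And>x. x \<in> A \<Longrightarrow> f x \<doteq> g x) \<Longrightarrow> sum f A \<doteq> sum g A"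
  by (induction A rule: infinite_finite_induct) (auto intro: rel_cong_add)

lemma rel_cong_free_deriv: "i \<in> {1..2*n} \<Longrightarrow> a \<doteq> b \<Longrightarrow> free_deriv i a \<doteq> free_deriv i b"
  using free_deriv_relation_ideal[of i n "a - b"] by (simp add: rel_cong_def free_deriv_diff)

text \<open>After swapping the summation indices in one copy, twice the square is the double sum of
  all anticommutators.\<close>

lemma sum_anticommuting_square:
  assumes "\<And>i j. i \<in> A \<Longrightarrow> j \<in> A \<Longrightarrow> f i * f j + f j * f i \<doteq> 0"
  shows "sum f A * sum f A \<doteq> 0"
proof -
  have "sum f A * sum f A + sum f A * sum f A = (\<Sum>i\<in>A. \<Sum>j\<in>A. f i * f j + f j * f i)"
    unfolding sum.distrib sum_product by (subst (2) sum.swap) simp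
  also have "\<dots> \<doteq> (\<Sum>i\<in>A. \<Sum>j\<in>A. 0)"
    by (intro rel_cong_sum assms)
  finally show ?thesis
    by (auto simp: rel_cong_0 intro: relation_ideal_halve)
qed

section \<open>The relations between the \<open>X\<close> and the \<open>W\<close>\<close>

lemma X_anticommute:
  "i \<in> {1..2*n} \<Longrightarrow> j \<in> {1..2*n} \<Longrightarrow> gen (X i) * gen (X j) + gen (X j) * gen (X i) \<in> relation_ideal n"
  by (rule relator_in_relation_ideal) (unfold relators_def, blast)

lemma W_X_commute:
  "i \<in> {1..2*n} \<Longrightarrow> j \<in> {1..2*n} \<Longrightarrow> gen (W i) * gen (X j) - gen (X j) * gen (W i) \<in> relation_ideal n"
  by (rule relator_in_relation_ideal) (unfold relators_def, blast)

lemma W_even_commute: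
  "i \<in> {1..n} \<Longrightarrow> j \<in> {1..n} \<Longrightarrow>
     gen (W (2*i)) * gen (W (2*j)) - gen (W (2*j)) * gen (W (2*i)) \<in> relation_ideal n"
  by (rule relator_in_relation_ideal) (unfold relators_def, blast)

lemma W_odd_commute:
  "i \<in> {1..n} \<Longrightarrow> j \<in> {1..n} \<Longrightarrow>
     gen (W (2*i-1)) * gen (W (2*j-1)) - gen (W (2*j-1)) * gen (W (2*i-1)) \<in> relation_ideal n"
  by (rule relator_in_relation_ideal) (unfold relators_def, blast)

lemma W_odd_even_commutator:
  "i \<in> {1..n} \<Longrightarrow> j \<in> {1..n} \<Longrightarrow>
     gen (W (2*i-1)) * gen (W (2*j)) - gen (W (2*j)) * gen (W (2*i-1)) - of_bool (i = j) \<in> relation_ideal n"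
  by (rule relator_in_relation_ideal) (unfold relators_def, blast)

text \<open>The \<open>X\<close> anticommute and slide past the \<open>W\<close>, so what survives
  is the commutator \<open>c\<close> of the two \<open>W\<close>. Equal indices are allowed.\<close>

lemma XW_anticommutator:
  assumes "i \<in> {1..2*n}" "j \<in> {1..2*n}"
    and "gen (W i) * gen (W j) - gen (W j) * gen (W i) - c \<in> relation_ideal n"
  shows "gen (X i) * gen (W i) * (gen (X j) * gen (W j)) + gen (X j) * gen (W j) * (gen (X i) * gen (W i))
    \<doteq> gen (X i) * gen (X j) * c"
proof -
  let ?xi = "gen (X i)" and ?xj = "gen (X j)" and ?wi = "gen (W i)" and ?wj = "gen (W j)"
  \<comment> \<open>The four ideal terms carry each \<open>W\<close> past an \<open>X\<close>
    (twice), exchange the two \<open>X\<close>, and replace the commutator by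
    \<open>c\<close>.\<close>
  have "?xi * ?wi * (?xj * ?wj) + ?xj * ?wj * (?xi * ?wi) - ?xi * ?xj * c
    = ?xi * (?wi * ?xj - ?xj * ?wi) * ?wj + ?xj * (?wj * ?xi - ?xi * ?wj) * ?wi
      + (?xi * ?xj + ?xj * ?xi) * (?wj * ?wi) + ?xi * ?xj * (?wi * ?wj - ?wj * ?wi - c)"
    by (simp add: algebra_simps)
  also have "\<dots> \<in> relation_ideal n"
    by (intro relation_ideal.add relation_ideal_mult_left relation_ideal_mult_right
        W_X_commute X_anticommute assms)
  finally show ?thesis by (simp add: rel_cong_def)
qed

section \<open>The square of the fermionic vector variable\<close>

definition xpair :: "nat \<Rightarrow> 'm free_alg" where
  "xpair j = gen (X (2*j-1)) * gen (X (2*j))"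

text \<open>The truncation to the first \<open>k\<close> pairs serves the induction in
  \<open>xsquare_top_power\<close>; elsewhere \<open>k = n\<close>.\<close>

definition xsquare :: "nat \<Rightarrow> 'm free_alg" where
  "xsquare k = (\<Sum>j=1..k. xpair j)"

lemma odd_even_range: "j \<in> {1..n} \<Longrightarrow> 2*j-1 \<in> {1..2*n}" "j \<in> {1..n} \<Longrightarrow> 2*j \<in> {1..2*n}"
  by auto

lemma sum_odd_even: "(\<Sum>j=1..2*k. f j) = (\<Sum>j=1..k. f (2*j-1)) + (\<Sum>j=1..k. f (2*j))"
  for f :: "nat \<Rightarrow> 'a::comm_monoid_add"
  by (induction k) (simp_all add: add_ac)

text \<open>The odd-indexed \<open>W\<close> commute among themselves, and so do the even-indexed
  ones, so both half sums square to zero. Of the mixed anticommutators only those within one pair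
  survive, the commutator there being 1.\<close>

lemma xgrave_square: "xgrave n ^ 2 \<doteq> xsquare n"
proof -
  let ?p = "\<lambda>j. gen (X (2*j-1)) * gen (W (2*j-1)) :: 'a free_alg"
  let ?r = "\<lambda>j. gen (X (2*j)) * gen (W (2*j)) :: 'a free_alg"
  let ?P = "\<Sum>j=1..n. ?p j" and ?R = "\<Sum>j=1..n. ?r j"
  have P: "?P * ?P \<doteq> 0"
  proof (rule sum_anticommuting_square)
    fix i j assume "i \<in> {1..n}" "j \<in> {1..n}"
    thus "?p i * ?p j + ?p j * ?p i \<doteq> 0"
      using XW_anticommutator[of "2*i-1" "2*j-1" 0] W_odd_commute[of i j] odd_even_range by simp
  qed
  have R: "?R * ?R \<doteq> 0"
  proof (rule sum_anticommuting_square)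
    fix i j assume "i \<in> {1..n}" "j \<in> {1..n}"
    thus "?r i * ?r j + ?r j * ?r i \<doteq> 0"
      using XW_anticommutator[of "2*i" "2*j" 0] W_even_commute[of i j] odd_even_range by simp
  qed
  have "(\<Sum>i=1..n. \<Sum>j=1..n. ?p i * ?r j + ?r j * ?p i)
      \<doteq> (\<Sum>i=1..n. \<Sum>j=1..n. gen (X (2*i-1)) * gen (X (2*j)) * of_bool (i = j))"
    by (intro rel_cong_sum XW_anticommutator odd_even_range W_odd_even_commutator)
  moreover have "?P * ?R + ?R * ?P = (\<Sum>i=1..n. \<Sum>j=1..n. ?p i * ?r j + ?r j * ?p i)"
    unfolding sum.distrib sum_product by (subst (2) sum.swap) (rule refl)
  moreover have "(\<Sum>i=1..n. \<Sum>j=1..n. gen (X (2*i-1)) * gen (X (2*j)) * of_bool (i = j)) = xsquare n"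
    unfolding xsquare_def
  proof (rule sum.cong[OF refl])
    fix i assume i: "i \<in> {1..n}"
    have "(\<Sum>j=1..n. gen (X (2*i-1)) * gen (X (2*j)) * of_bool (i = j))
        = (\<Sum>j=1..n. if i = j then xpair j else 0)"
      by (rule sum.cong) (simp_all add: xpair_def)
    thus "(\<Sum>j=1..n. gen (X (2*i-1)) * gen (X (2*j)) * of_bool (i = j)) = xpair i"
      using i by simp
  qed
  ultimately have PR: "?P * ?R + ?R * ?P \<doteq> xsquare n" by metis
  have "xgrave n = ?P + ?R" by (simp only: xgrave_def sum_odd_even)
  hence "xgrave n ^ 2 = ?P * ?P + (?P * ?R + ?R * ?P) + ?R * ?R"
    by (simp add: power2_eq_square algebra_simps)
  also have "\<dots> \<doteq> 0 + xsquare n + 0" by (intro rel_cong_add P R PR)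
  finally show ?thesis by simp
qed

lemma xgrave_even_power: "xgrave n ^ (2*k) \<doteq> xsquare n ^ k"
  unfolding power_mult by (rule rel_cong_power[OF xgrave_square])

section \<open>Commutation and nilpotency of the pairs, top power of their sum\<close>

lemma xpair_X_commute:
  assumes "j \<in> {1..n}" "i \<in> {1..2*n}"
  shows "xpair j * gen (X i) \<doteq> gen (X i) * xpair j"
proof -
  let ?a = "gen (X (2*j-1))" and ?b = "gen (X (2*j))" and ?x = "gen (X i)"
  \<comment> \<open>Two exchanges of anticommuting factors, whose signs cancel. The relators cover
    equal indices, so \<open>?x\<close> may itself belong to the pair.\<close>
  have "?a * ?b * ?x - ?x * (?a * ?b) = ?a * (?b * ?x + ?x * ?b) - (?a * ?x + ?x * ?a) * ?b"
    by (simp add: algebra_simps)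
  also have "\<dots> \<in> relation_ideal n"
    by (intro relation_ideal_diff relation_ideal_mult_left relation_ideal_mult_right
        X_anticommute odd_even_range assms)
  finally show ?thesis by (simp add: rel_cong_def xpair_def)
qed

lemma xsquare_X_commute:
  assumes "k \<le> n" "i \<in> {1..2*n}"
  shows "xsquare k * gen (X i) \<doteq> gen (X i) * xsquare k"
  unfolding xsquare_def sum_distrib_left sum_distrib_right
  by (intro rel_cong_sum xpair_X_commute) (use assms in auto)

lemma xsquare_xpair_commute:
  assumes "k \<le> n" "j \<in> {1..n}"
  shows "xsquare k * xpair j \<doteq> xpair j * xsquare k"
proof -
  let ?a = "gen (X (2*j-1))" and ?b = "gen (X (2*j))"
  have "xsquare k * xpair j = xsquare k * ?a * ?b" by (simp add: xpair_def mult.assoc)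
  also have "\<dots> \<doteq> ?a * xsquare k * ?b"
    by (intro rel_cong_mult xsquare_X_commute odd_even_range assms rel_cong_refl)
  also have "\<dots> = ?a * (xsquare k * ?b)" by (simp add: mult.assoc)
  also have "\<dots> \<doteq> ?a * (?b * xsquare k)"
    by (intro rel_cong_mult xsquare_X_commute odd_even_range assms rel_cong_refl)
  finally show ?thesis by (simp add: xpair_def mult.assoc)
qed

text \<open>Carrying \<open>?a\<close> through the whole pair in front of it brings the two copies
  of \<open>?a\<close> together, and \<open>?a * ?a\<close> vanishes.\<close>

lemma xpair_square:
  assumes "j \<in> {1..n}" shows "xpair j * xpair j \<doteq> 0"
proof -
  let ?a = "gen (X (2*j-1))" and ?b = "gen (X (2*j))"
  have aa: "?a * ?a \<doteq> 0"
    unfolding rel_cong_0 by (rule relation_ideal_halve[OF X_anticommute]) (use assms in auto)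
  have "xpair j * xpair j = xpair j * ?a * ?b" by (simp add: xpair_def mult.assoc)
  also have "\<dots> \<doteq> ?a * xpair j * ?b"
    by (intro rel_cong_mult xpair_X_commute odd_even_range assms rel_cong_refl)
  also have "\<dots> = ?a * ?a * (?b * ?b)" by (simp add: xpair_def mult.assoc)
  also have "\<dots> \<doteq> 0 * (?b * ?b)" by (intro rel_cong_mult aa rel_cong_refl)
  finally show ?thesis by simp
qed

text \<open>The binomial expansion breaks off after the linear term because \<open>y\<close> squares
  to zero. The exponent \<open>Suc k\<close> avoids a truncated \<open>k - 1\<close>.\<close>

lemma power_add_square_zero:
  assumes comm: "a * y \<doteq> y * a" and sq: "y * y \<doteq> 0"
  shows "(a + y) ^ Suc k \<doteq> a ^ Suc k + of_nat (Suc k) * (a ^ k * y)"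
proof (induction k)
  case 0
  show ?case by simp
next
  case (Suc k)
  let ?c = "of_nat (Suc k)"
  have "(a + y) ^ Suc (Suc k) = (a + y) ^ Suc k * (a + y)" by (rule power_Suc2)
  also have "\<dots> \<doteq> (a ^ Suc k + ?c * (a ^ k * y)) * (a + y)"
    by (rule rel_cong_mult[OF Suc rel_cong_refl])
  also have "\<dots> = a ^ Suc (Suc k) + a ^ Suc k * y + ?c * (a ^ k * (y * a)) + ?c * (a ^ k * (y * y))"
    unfolding power_Suc2[of a "Suc k"] by (simp only: algebra_simps)
  also have "\<dots> \<doteq> a ^ Suc (Suc k) + a ^ Suc k * y + ?c * (a ^ k * (a * y)) + ?c * (a ^ k * 0)"
    by (intro rel_cong_add rel_cong_mult rel_cong_refl sq rel_cong_sym[OF comm])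
  also have "\<dots> = a ^ Suc (Suc k) + of_nat (Suc (Suc k)) * (a ^ Suc k * y)"
    unfolding of_nat_Suc[of "Suc k"] distrib_right power_Suc2[of a k] by (simp add: mult.assoc)
  finally show ?case .
qed

text \<open>Both claims need a common induction. Adding a pair \<open>?y\<close> to
  \<open>?q\<close> gives \<open>?q ^ Suc k + Suc k * ?q ^ k * ?y\<close>: nilpotency removes the
  first term and the top power evaluates the second. One exponent higher, both terms contain
  \<open>?q ^ Suc k\<close> and vanish.\<close>

lemma xsquare_top_power:
  assumes "k \<le> n"
  shows "(xsquare k :: 'm free_alg) ^ k \<doteq> of_nat (fact k) * prod_list (map (\<lambda>j. gen (X j)) [1..<2*k+1])"
    and "(xsquare k :: 'm free_alg) ^ Suc k \<doteq> 0"
proof -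
  let ?X = "\<lambda>k. prod_list (map (\<lambda>j. gen (X j)) [1..<2*k+1]) :: 'm free_alg"
  have "xsquare k ^ k \<doteq> of_nat (fact k) * ?X k \<and> (xsquare k :: 'm free_alg) ^ Suc k \<doteq> 0"
    using assms
  proof (induction k)
    case 0
    show ?case by (simp add: xsquare_def)
  next
    case (Suc k)
    let ?q = "xsquare k :: 'm free_alg" and ?y = "xpair (Suc k) :: 'm free_alg"
    from Suc have top: "?q ^ k \<doteq> of_nat (fact k) * ?X k" and null: "?q ^ Suc k \<doteq> 0"
      by (blast dest: Suc_leD)+
    have q: "xsquare (Suc k) = ?q + ?y" by (simp add: xsquare_def)
    \<comment> \<open>The index list grows by \<open>2*k+1\<close> and \<open>2*k+2\<close>, exactly
      the new pair.\<close>
    have X: "?X (Suc k) = ?X k * ?y" by (simp add: xpair_def mult.assoc)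
    have pow: "xsquare (Suc k) ^ Suc l \<doteq> ?q ^ Suc l + of_nat (Suc l) * (?q ^ l * ?y)" for l
      unfolding q
      by (intro power_add_square_zero xsquare_xpair_commute xpair_square) (use Suc.prems in auto)
    have "xsquare (Suc k) ^ Suc k \<doteq> 0 + of_nat (Suc k) * (of_nat (fact k) * ?X k * ?y)"
      by (rule rel_cong_trans[OF pow], intro rel_cong_add rel_cong_mult null top rel_cong_refl)
    also have "\<dots> = of_nat (fact (Suc k)) * ?X (Suc k)"
      unfolding X fact_Suc of_nat_mult of_nat_id by (simp only: add_0_left mult.assoc)
    finally have 1: "xsquare (Suc k) ^ Suc k \<doteq> of_nat (fact (Suc k)) * ?X (Suc k)" .
    have "xsquare (Suc k) ^ Suc (Suc k) \<doteq> ?q * 0 + of_nat (Suc (Suc k)) * (0 * ?y)"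
      by (rule rel_cong_trans[OF pow], subst power_Suc,
          intro rel_cong_add rel_cong_mult null rel_cong_refl)
    with 1 show ?case by simp
  qed
  thus "xsquare k ^ k \<doteq> of_nat (fact k) * ?X k" "(xsquare k :: 'm free_alg) ^ Suc k \<doteq> 0"
    by blast+
qed

section \<open>The fermionic Laplacian of powers of the square\<close>

lemma free_deriv_X_mult: "free_deriv j (gen (X k) * a) = of_bool (j = k) * a - gen (X k) * free_deriv j a"
  by (simp add: free_deriv_gen_mult)

text \<open>A pair has even degree, so a derivative passes it without a sign.\<close>

lemma free_deriv_xpair_odd:
  assumes "j \<ge> 1" "i \<ge> 1"
  shows "free_deriv (2*j-1) (xpair i * a) = of_bool (i = j) * (gen (X (2*j)) * a) + xpair i * free_deriv (2*j-1) a"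
proof -
  \<comment> \<open>At index 0 truncated subtraction makes \<open>2*i-1\<close> and
    \<open>2*i\<close> coincide; from 1 on, parity separates them.\<close>
  have "2*j-1 \<noteq> 2*i" "2*j-1 = 2*i-1 \<longleftrightarrow> i = j" using assms by presburger+
  thus ?thesis by (auto simp: xpair_def mult.assoc free_deriv_X_mult)
qed

text \<open>The minus sign arises because the derivative first has to pass the odd-indexed variable
  of the pair.\<close>

lemma free_deriv_xpair_even:
  assumes "j \<ge> 1" "i \<ge> 1"
  shows "free_deriv (2*j) (xpair i * a) = of_bool (i = j) * (- gen (X (2*j-1)) * a) + xpair i * free_deriv (2*j) a"
proof -
  have "2*j \<noteq> 2*i-1" "2*j = 2*i \<longleftrightarrow> i = j" using assms by presburger+
  thus ?thesis by (auto simp: xpair_def mult.assoc free_deriv_X_mult algebra_simps)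
qed

text \<open>Covers \<open>l = 2*j-1\<close> and \<open>l = 2*j\<close> at once; \<open>b\<close> is
  the term contributed by pair \<open>j\<close>, the only one affected.\<close>

lemma free_deriv_xsquare:
  assumes "j \<in> {1..n}"
    and "\<And>i. i \<in> {1..n} \<Longrightarrow> free_deriv l (xpair i * a) = of_bool (i = j) * b + xpair i * free_deriv l a"
  shows "free_deriv l (xsquare n * a) = b + xsquare n * free_deriv l a"
proof -
  have "free_deriv l (xsquare n * a)
      = (\<Sum>i=1..n. of_bool (i = j) * b) + (\<Sum>i=1..n. xpair i * free_deriv l a)"
    unfolding xsquare_def sum_distrib_right free_deriv_sum sum.distrib[symmetric]
    by (intro sum.cong refl assms(2))
  also have "(\<Sum>i=1..n. of_bool (i = j) * b) = (\<Sum>i=1..n. if j = i then b else 0)"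
    by (intro sum.cong) auto
  also have "\<dots> = b" using assms(1) by simp
  finally show ?thesis by (simp add: xsquare_def sum_distrib_right)
qed

lemma free_deriv_one [simp]: "free_deriv l (1 :: 'm free_alg) = 0"
proof -
  have "free_deriv l (Poly_Mapping.single 0 1 :: 'm free_alg) = 0"
    unfolding free_deriv_single by (simp add: word_deriv_def zero_word_def)
  thus ?thesis by simp
qed

lemma mult_of_nat_left_commute: "a * (of_nat k * b) = of_nat k * (a * b)" for a b :: "'a::semiring_1"
  by (simp only: mult.assoc[symmetric] mult_of_nat_commute[of k a])

text \<open>The power rule, with \<open>z\<close> the derivative of \<open>xsquare n\<close> (take
  \<open>a = 1\<close> in \<open>deriv\<close>). Commutation collects every \<open>z\<close> in
  front; at \<open>k = 0\<close> the factor \<open>of_nat k\<close> annihilates the truncated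
  exponent.\<close>

lemma free_deriv_xsquare_power:
  assumes "l \<in> {1..2*n}" and comm: "xsquare n * z \<doteq> z * xsquare n"
    and deriv: "\<And>a. free_deriv l (xsquare n * a) = z * a + xsquare n * free_deriv l a"
  shows "free_deriv l (xsquare n ^ k) \<doteq> of_nat k * (z * xsquare n ^ (k - 1))"
proof (induction k)
  case 0
  show ?case by simp
next
  case (Suc k)
  let ?q = "xsquare n"
  have "free_deriv l (?q ^ Suc k) \<doteq> z * ?q ^ k + ?q * (of_nat k * (z * ?q ^ (k - 1)))"
    unfolding power_Suc deriv by (intro rel_cong_add rel_cong_mult Suc rel_cong_refl)
  also have "?q * (of_nat k * (z * ?q ^ (k - 1))) = of_nat k * (?q * z * ?q ^ (k - 1))"
    by (simp only: mult_of_nat_left_commute mult.assoc)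
  also have "z * ?q ^ k + \<dots> \<doteq> z * ?q ^ k + of_nat k * (z * ?q * ?q ^ (k - 1))"
    by (intro rel_cong_add rel_cong_mult comm rel_cong_refl)
  also have "\<dots> = of_nat (Suc k) * (z * ?q ^ (Suc k - 1))"
    by (cases k) (simp_all add: algebra_simps)
  finally show ?case .
qed

lemma free_deriv_of_nat_mult: "free_deriv l (of_nat c * a) = of_nat c * free_deriv l a"
  by (induction c) (simp_all add: free_deriv_add distrib_right)

text \<open>The factor 4 of \<open>super_laplace_f\<close> is left out;
  \<open>super_laplace_tensor\<close> attaches it to the distribution.\<close>

definition free_laplace_f :: "'m free_alg \<Rightarrow> 'm free_alg" where
  "free_laplace_f a = (\<Sum>j=1..n. free_deriv (2*j-1) (free_deriv (2*j) a))"

text \<open>For each \<open>j\<close> the odd derivative either removes the \<open>?a\<close> left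
  by the even one, giving \<open>- ?q ^ k\<close>, or hits the power, giving \<open>k\<close> times
  \<open>xpair j * ?q ^ (k - 1)\<close>. Summed over \<open>j\<close>, the former are counted
  \<open>n\<close> times and the pairs reassemble to \<open>?q\<close>.\<close>

lemma free_laplace_f_xsquare_power:
  "free_laplace_f ((xsquare n :: 'm free_alg) ^ Suc k) \<doteq> of_nat (Suc k) * ((of_nat k - of_nat n) * xsquare n ^ k)"
proof -
  let ?q = "xsquare n :: 'm free_alg" and ?c = "of_nat (Suc k) :: 'm free_alg"
  have summand: "free_deriv (2*j-1) (free_deriv (2*j) (?q ^ Suc k))
      \<doteq> ?c * (of_nat k * (xpair j * ?q ^ (k - 1)) - ?q ^ k)" if j: "j \<in> {1..n}" for j
  proof -
    let ?a = "gen (X (2*j-1))" and ?b = "gen (X (2*j))"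
    have comm: "?q * ?a \<doteq> ?a * ?q" "?q * ?b \<doteq> ?b * ?q"
      using j by (intro xsquare_X_commute odd_even_range order_refl; simp)+
    have even: "free_deriv (2*j) (?q ^ Suc k) \<doteq> ?c * (- ?a * ?q ^ (Suc k - 1))"
    proof (rule free_deriv_xsquare_power)
      show "free_deriv (2*j) (?q * a) = - ?a * a + ?q * free_deriv (2*j) a" for a
        by (rule free_deriv_xsquare[OF j], rule free_deriv_xpair_even) (use j in auto)
    qed (use j comm rel_cong_uminus in auto)
    have odd: "free_deriv (2*j-1) (?q ^ k) \<doteq> of_nat k * (?b * ?q ^ (k - 1))"
    proof (rule free_deriv_xsquare_power)
      show "free_deriv (2*j-1) (?q * a) = ?b * a + ?q * free_deriv (2*j-1) a" for a
        by (rule free_deriv_xsquare[OF j], rule free_deriv_xpair_odd) (use j in auto)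
    qed (use j comm in auto)
    have "free_deriv (2*j-1) (free_deriv (2*j) (?q ^ Suc k))
        \<doteq> free_deriv (2*j-1) (?c * (- ?a * ?q ^ (Suc k - 1)))"
      by (rule rel_cong_free_deriv[OF odd_even_range(1)[OF j] even])
    \<comment> \<open>Leibniz rule on \<open>?a * ?q ^ k\<close>, with both signs reversed by the
      minus from the even derivative.\<close>
    also have "\<dots> = ?c * (?a * free_deriv (2*j-1) (?q ^ k) - ?q ^ k)"
      unfolding free_deriv_of_nat_mult by (simp add: free_deriv_uminus free_deriv_X_mult)
    also have "\<dots> \<doteq> ?c * (?a * (of_nat k * (?b * ?q ^ (k - 1))) - ?q ^ k)"
      by (intro rel_cong_mult rel_cong_diff odd rel_cong_refl)
    also have "?a * (of_nat k * (?b * ?q ^ (k - 1))) = of_nat k * (xpair j * ?q ^ (k - 1))"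
      by (simp only: xpair_def mult_of_nat_left_commute mult.assoc)
    finally show ?thesis .
  qed
  have "free_laplace_f (?q ^ Suc k) \<doteq> (\<Sum>j=1..n. ?c * (of_nat k * (xpair j * ?q ^ (k - 1)) - ?q ^ k))"
    unfolding free_laplace_f_def by (intro rel_cong_sum summand)
  also have "\<dots> = ?c * (of_nat k * (?q * ?q ^ (k - 1)) - of_nat n * ?q ^ k)"
    unfolding sum_distrib_left[symmetric] sum_subtractf sum_distrib_right[symmetric] xsquare_def[symmetric]
    by simp
  also have "of_nat k * (?q * ?q ^ (k - 1)) = of_nat k * ?q ^ k"
    by (cases k) simp_all
  finally show ?thesis by (simp only: left_diff_distrib)
qed

lemma free_laplace_f_one: "free_laplace_f 1 = 0"
  by (simp add: free_laplace_f_def)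

section \<open>The super Laplacian of the fundamental solution\<close>

lemma super_eq_refl: "super_eq n u u"
  by (simp add: super_eq_def super_null_zero)

lemma super_eq_trans [trans]: "super_eq n u v \<Longrightarrow> super_eq n v w \<Longrightarrow> super_eq n u w"
  using super_null_add[of "u - v" n "v - w"] by (simp add: super_eq_def)

lemma super_eq_add: "super_eq n u v \<Longrightarrow> super_eq n u' v' \<Longrightarrow> super_eq n (u + u') (v + v')"
  using super_null_add[of "u - v" n "u' - v'"] by (simp add: super_eq_def algebra_simps)

lemma super_eq_sum: "(\<And>x. x \<in> A \<Longrightarrow> super_eq n (f x) (g x)) \<Longrightarrow> super_eq n (sum f A) (sum g A)"
  by (induction A rule: infinite_finite_induct) (auto intro: super_eq_add super_eq_refl)

section \<open>From the free algebra to super distributions\<close>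

lemma tensor_uminus_right: "T \<otimes>\<^sub>D (- a) = - (T \<otimes>\<^sub>D a)"
  by (rule poly_mapping_eqI) (simp add: lookup_tensor)

lemma tensor_uminus_left: "(- T) \<otimes>\<^sub>D a = - (T \<otimes>\<^sub>D a)"
  by (rule poly_mapping_eqI) (simp add: lookup_tensor)

lemma tensor_sum_left: "sum f A \<otimes>\<^sub>D a = (\<Sum>x\<in>A. f x \<otimes>\<^sub>D a)"
  by (induction A rule: infinite_finite_induct) (simp_all add: tensor_add_left)

lemma tensor_of_nat_mult: "T \<otimes>\<^sub>D (of_nat c * a) = (real c *\<^sub>R T) \<otimes>\<^sub>D a"
  by (rule poly_mapping_eqI)
     (simp add: lookup_tensor lookup_single_zero_mult single_of_nat[symmetric] mult.commute del: single_of_nat)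

lemma tensor_cong: "a \<doteq> b \<Longrightarrow> super_eq n (T \<otimes>\<^sub>D a) (T \<otimes>\<^sub>D b)"
  using super_null_tensor[of "a - b" n T] tensor_add_right[of T a "- b"]
  by (simp add: rel_cong_def super_eq_def tensor_uminus_right)

lemma linear_laplace_b: "linear (laplace_b :: 'm::finite distr \<Rightarrow> _)"
  by (rule linearI)
     (simp_all add: laplace_b_def linear_add[OF linear_distr_pderiv] linear_scale[OF linear_distr_pderiv]
        sum.distrib scaleR_sum_right)

text \<open>On an elementary tensor the bosonic part acts on the distribution only, the fermionic
  part on the algebra factor only.\<close>

lemma super_laplace_tensor:
  "super_laplace n (T \<otimes>\<^sub>D a) = laplace_b T \<otimes>\<^sub>D a + (4 *\<^sub>R T) \<otimes>\<^sub>D free_laplace_f a"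
  by (simp add: super_laplace_def super_laplace_b_def super_laplace_f_def laplace_b_def free_laplace_f_def
        super_pderiv_tensor left_deriv_tensor tensor_uminus_left tensor_sum_left
        super_scale_sum super_scale_tensor tensor_sum_right)

lemma super_laplace_sum: "super_laplace n (sum f A) = (\<Sum>x\<in>A. super_laplace n (f x))"
proof -
  have "super_laplace n 0 = (0 :: 'm::finite superdistr)"
    using super_laplace_add[of n 0 0] by simp
  thus ?thesis
    by (induction A rule: infinite_finite_induct) (simp_all add: super_laplace_add)
qed

end

section \<open>The telescoping sum\<close>

theorem theorem2:
  fixes n :: nat and \<nu> :: "nat \<Rightarrow> 'm::finite distr"
  assumes "\<And>j l. 1 \<le> l \<Longrightarrow> j < l \<Longrightarrow> (laplace_b ^^ j) (\<nu> (2*l)) = \<nu> (2*l - 2*j)"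
    and "\<And>l. 1 \<le> l \<Longrightarrow> (laplace_b ^^ l) (\<nu> (2*l)) = dirac"
  shows "super_fundamental_solution n (super_nu n \<nu>)"
proof -
  let ?q = "xsquare n :: 'm free_alg"
  define c :: "nat \<Rightarrow> real" where "c k = 4 ^ k * fact k / fact (n - k)" for k
  \<comment> \<open>Extending the sequence by the Dirac distribution at index 0 merges the two
    hypotheses into one descent rule.\<close>
  define \<mu> where "\<mu> k = (if k = 0 then dirac else \<nu> (2*k))" for k
  \<comment> \<open>The default 0 beyond \<open>n\<close> makes the last term
    \<open>t (Suc n)\<close> of the telescoping sum vanish.\<close>
  define t where "t k = (if k \<le> n then (c k *\<^sub>R \<mu> k) \<otimes>\<^sub>D ?q ^ (n - k) else 0)" for k
  have \<mu>: "laplace_b (\<nu> (2*k+2)) = \<mu> k" for k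
  proof (cases k)
    case 0
    have "(laplace_b ^^ 1) (\<nu> (2 * 1)) = dirac"
      by (rule assms(2)) simp
    thus ?thesis using 0 by (simp add: \<mu>_def numeral_2_eq_2)
  next
    case (Suc l)
    have "(laplace_b ^^ 1) (\<nu> (2 * Suc k)) = \<nu> (2 * Suc k - 2 * 1)"
      by (rule assms(1)) (simp_all add: Suc)
    thus ?thesis by (simp add: \<mu>_def Suc)
  qed
  have step: "super_eq n (super_laplace n ((c k *\<^sub>R \<nu> (2*k+2)) \<otimes>\<^sub>D ?q ^ (n - k))) (t k - t (Suc k))"
    if k: "k \<le> n" for k
  proof -
    have b: "laplace_b (c k *\<^sub>R \<nu> (2*k+2)) \<otimes>\<^sub>D ?q ^ (n - k) = t k"
      using k by (simp add: linear_scale[OF linear_laplace_b] \<mu>[simplified] t_def)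
    have f: "super_eq n ((4 *\<^sub>R c k *\<^sub>R \<nu> (2*k+2)) \<otimes>\<^sub>D free_laplace_f n (?q ^ (n - k))) (- t (Suc k))"
    proof (cases "k = n")
      \<comment> \<open>Here the algebra factor is \<open>?q ^ 0 = 1\<close>, which the derivatives
        kill, in agreement with \<open>t (Suc n) = 0\<close>.\<close>
      case True
      thus ?thesis by (simp add: t_def free_laplace_f_one super_eq_refl)
    next
      case False
      with k obtain p where p: "n = k + Suc p" by (metis add_Suc_right le_neq_implies_less less_imp_Suc_add)
      have coeff: "of_nat (Suc p) * ((of_nat p - of_nat n) * ?q ^ p)
          = - (of_nat (Suc p * Suc k) * ?q ^ p)"
      proof -
        have "of_nat p - of_nat n = (- of_nat (Suc k) :: 'm free_alg)" by (simp add: p)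
        thus ?thesis
          by (simp only: of_nat_mult mult.assoc mult_minus_left mult_minus_right)
      qed
      \<comment> \<open>With \<open>n - k = Suc p\<close> this is the recursion
        \<open>c (k+1) = 4 * (k+1) * (n-k) * c k\<close>, which dictates the coefficients of
        \<open>super_nu\<close>.\<close>
      have scal: "real (Suc p * Suc k) * (4 * c k) = c (Suc k)"
        unfolding c_def p by (simp add: divide_simps del: of_nat_Suc mult_Suc mult_Suc_right)
      have "super_eq n ((4 *\<^sub>R c k *\<^sub>R \<nu> (2*k+2)) \<otimes>\<^sub>D free_laplace_f n (?q ^ (n - k)))
          ((4 *\<^sub>R c k *\<^sub>R \<nu> (2*k+2)) \<otimes>\<^sub>D (- (of_nat (Suc p * Suc k) * ?q ^ p)))"
      proof (rule tensor_cong)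
        have "n - k = Suc p" by (simp add: p)
        thus "rel_cong n (free_laplace_f n (?q ^ (n - k))) (- (of_nat (Suc p * Suc k) * ?q ^ p))"
          unfolding coeff[symmetric] by (simp only: free_laplace_f_xsquare_power)
      qed
      also have "(4 *\<^sub>R c k *\<^sub>R \<nu> (2*k+2)) \<otimes>\<^sub>D (- (of_nat (Suc p * Suc k) * ?q ^ p)) = - t (Suc k)"
        unfolding tensor_uminus_right tensor_of_nat_mult scaleR_scaleR scal
        by (simp add: t_def \<mu>_def p)
      finally show ?thesis .
    qed
    have "super_eq n (t k + (4 *\<^sub>R c k *\<^sub>R \<nu> (2*k+2)) \<otimes>\<^sub>D free_laplace_f n (?q ^ (n - k))) (t k + - t (Suc k))"
      by (intro super_eq_add super_eq_refl f)
    thus ?thesis unfolding super_laplace_tensor b by simp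
  qed
  \<comment> \<open>The exponent \<open>2*n - 2*k\<close> is \<open>2 * (n - k)\<close>, so only
    even powers of \<open>xgrave n\<close> occur. \<open>super_laplace_cong\<close> then permits
    changing the representative under the operator.\<close>
  have "super_eq n (super_nu n \<nu>) (\<Sum>k=0..n. (c k *\<^sub>R \<nu> (2*k+2)) \<otimes>\<^sub>D ?q ^ (n - k))"
    unfolding super_nu_def super_scale_tensor c_def diff_mult_distrib2[symmetric]
    by (intro super_eq_sum tensor_cong xgrave_even_power)
  hence "super_eq n (super_laplace n (super_nu n \<nu>))
      (super_laplace n (\<Sum>k=0..n. (c k *\<^sub>R \<nu> (2*k+2)) \<otimes>\<^sub>D ?q ^ (n - k)))"
    by (rule super_laplace_cong)
  also have "super_eq n \<dots> (\<Sum>k=0..n. t k - t (Suc k))"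
    unfolding super_laplace_sum by (intro super_eq_sum step) simp
  also have "(\<Sum>k=0..n. t k - t (Suc k)) = (c 0 *\<^sub>R dirac) \<otimes>\<^sub>D ?q ^ n"
    unfolding atLeast0AtMost sum_telescope by (simp add: t_def \<mu>_def)
  also have "super_eq n \<dots> ((c 0 *\<^sub>R dirac) \<otimes>\<^sub>D
      (of_nat (fact n) * prod_list (map (\<lambda>j. gen (X j)) [1..<2*n+1])))"
    by (intro tensor_cong xsquare_top_power order_refl)
  \<comment> \<open>The factor \<open>c 0 = 1 / fact n\<close> cancels the \<open>fact n\<close>
    from the top power.\<close>
  also have "\<dots> = super_dirac n"
    unfolding tensor_of_nat_mult super_dirac_def by (simp add: c_def)
  finally show ?thesis unfolding super_fundamental_solution_def .
qed

end
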